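(* Let $R$ be an infinite integral domain. Then the following are equivalent: (i) for every partition of $R$ into finitely many cells, at least one cell is both additively central and multiplicatively central; (ii) $R$ is a large Integral Domain.
   Context: An integral domain $R$ is called a large Integral Domain if every nonzero ideal of $R$ has finite index in $R$ (as an additive subgroup). For a discrete semigroup $(S,\cdot)$, $\beta S$ is its Stone–Čech compactification (the set of ultrafilters on $S$), made into a compact right topological semigroup by: $A\in p\cdot q$ if and only if $\{x\in S:x^{-1}A\in q\}\in p$, where $x^{-1}A=\{y\in S:x\cdot y\in A\}$. An idempotent of $\beta S$ is minimal if it belongs to the smallest two-sided ideal $K(\beta S)$. A set $A\subseteq S$ is central in $S$ if $A\in p$ for some minimal idempotent $p$ of $\beta S$. A subset $C\subseteq R$ is additively central if it is central in the semigroup $(R,+)$, and multiplicatively central if $C\setminus\{0\}$ is central in the semigroup $(R\setminus\{0\},\cdot)$. *)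

theory Defs
  imports "HOL-Algebra.Algebra" "HOL-Library.Disjoint_Sets"
begin

text \<open>
  A discrete semigroup is given by the carrier and the multiplication of a record of type
  \<^typ>\<open>('a, 'm) monoid_scheme\<close>; its unit field plays no role below. Points of its
  Stone-Cech compactification are ultrafilters, represented as families of subsets of the carrier.
\<close>

definition ultrafilter_on :: "'a set \<Rightarrow> 'a set set \<Rightarrow> bool" where
  "ultrafilter_on S p \<longleftrightarrow>
     p \<subseteq> Pow S \<and> S \<in> p \<and> {} \<notin> p \<and>
     (\<forall>A\<in>p. \<forall>B\<in>p. A \<inter> B \<in> p) \<and>
     (\<forall>A\<in>p. \<forall>B. A \<subseteq> B \<and> B \<subseteq> S \<longrightarrow> B \<in> p) \<and>
     (\<forall>A. A \<subseteq> S \<longrightarrow> A \<in> p \<or> S - A \<in> p)"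

definition stone_cech :: "('a, 'm) monoid_scheme \<Rightarrow> 'a set set set" where
  "stone_cech S = {p. ultrafilter_on (carrier S) p}"

definition left_preimage :: "('a, 'm) monoid_scheme \<Rightarrow> 'a \<Rightarrow> 'a set \<Rightarrow> 'a set" where
  "left_preimage S x A = {y \<in> carrier S. x \<otimes>\<^bsub>S\<^esub> y \<in> A}"

definition beta_mult :: "('a, 'm) monoid_scheme \<Rightarrow> 'a set set \<Rightarrow> 'a set set \<Rightarrow> 'a set set" where
  "beta_mult S p q =
     {A. A \<subseteq> carrier S \<and> {x \<in> carrier S. left_preimage S x A \<in> q} \<in> p}"

definition two_sided_ideal :: "'b set \<Rightarrow> ('b \<Rightarrow> 'b \<Rightarrow> 'b) \<Rightarrow> 'b set \<Rightarrow> bool" where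
  "two_sided_ideal T m I \<longleftrightarrow>
     I \<subseteq> T \<and> I \<noteq> {} \<and> (\<forall>t\<in>T. \<forall>i\<in>I. m t i \<in> I \<and> m i t \<in> I)"

text \<open>
  The intersection of all two-sided ideals; if a smallest two-sided ideal exists, this is it
  (see the lemma below), and for the compact right topological semigroup of ultrafilters
  one does exist.
\<close>

definition smallest_ideal :: "'b set \<Rightarrow> ('b \<Rightarrow> 'b \<Rightarrow> 'b) \<Rightarrow> 'b set" where
  "smallest_ideal T m = \<Inter> {I. two_sided_ideal T m I}"

lemma smallest_ideal_eqI:
  assumes "two_sided_ideal T m I" and "\<And>J. two_sided_ideal T m J \<Longrightarrow> I \<subseteq> J"
  shows "smallest_ideal T m = I"
  using assms unfolding smallest_ideal_def by blast

definition minimal_idempotent :: "('a, 'm) monoid_scheme \<Rightarrow> 'a set set \<Rightarrow> bool" where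
  "minimal_idempotent S p \<longleftrightarrow>
     p \<in> stone_cech S \<and> beta_mult S p p = p \<and>
     p \<in> smallest_ideal (stone_cech S) (beta_mult S)"

definition central :: "('a, 'm) monoid_scheme \<Rightarrow> 'a set \<Rightarrow> bool" where
  "central S A \<longleftrightarrow> (\<exists>p. minimal_idempotent S p \<and> A \<in> p)"

definition additively_central :: "('a, 'm) ring_scheme \<Rightarrow> 'a set \<Rightarrow> bool" where
  "additively_central R C \<longleftrightarrow> central (add_monoid R) C"

definition multiplicatively_central :: "('a, 'm) ring_scheme \<Rightarrow> 'a set \<Rightarrow> bool" where
  "multiplicatively_central R C \<longleftrightarrow> central (Multiplicative_Group.mult_of R) (C - {\<zero>\<^bsub>R\<^esub>})"

definition large_integral_domain :: "('a, 'm) ring_scheme \<Rightarrow> bool" where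
  "large_integral_domain R \<longleftrightarrow>
     domain R \<and> (\<forall>I. ideal I R \<and> I \<noteq> {\<zero>\<^bsub>R\<^esub>} \<longrightarrow> finite (a_rcosets\<^bsub>R\<^esub> I))"

end

theory Submission
  imports Defs "HOL-Analysis.T1_Spaces"
begin

text \<open>
  If a nonzero ideal \<open>I\<close> has infinite index, split \<open>R\<close> into \<open>I\<close> and its complement. The ultrafilters
  containing no coset of \<open>I\<close> form a two-sided ideal of \<open>\<beta>(R,+)\<close>, so \<open>I\<close> is not additively central;
  those containing \<open>I - {0}\<close> form a two-sided ideal of \<open>\<beta>(R - {0},\<cdot>)\<close>, so the complement is not
  multiplicatively central.

  Conversely, let all nonzero ideals have finite index and let \<open>x \<noteq> 0\<close>. Every two-sided ideal of
  \<open>\<beta>(R,+)\<close> meets the image of \<open>\<beta>R\<close> under multiplication by \<open>x\<close>, because some coset of \<open>xR\<close> belongs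
  to any given ultrafilter and can be translated to \<open>xR\<close>. Pulling such ideals back shows that
  multiplication by \<open>x\<close> preserves minimal idempotents, hence additive centrality. So the ultrafilters
  all of whose members are additively central form a closed left ideal of \<open>\<beta>(R - {0},\<cdot>)\<close>, which
  contains a multiplicatively minimal idempotent by Ellis' theorem.
\<close>

section \<open>Compact right topological semigroups\<close>

text \<open>Zorn's lemma for reverse inclusion; compactness keeps the intersection of a chain
  nonempty. \<open>P\<close> stands for any property inherited by intersections, later being closed
  under \<open>m\<close> and being a left ideal.\<close>

lemma compact_space_minimal_closed:
  assumes "compact_space T" "closedin T A" "A \<noteq> {}" "P A"
    and Inter: "\<And>\<C>. \<C> \<noteq> {} \<Longrightarrow> \<forall>C\<in>\<C>. P C \<Longrightarrow> P (\<Inter>\<C>)"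
  obtains M where "M \<subseteq> A" "closedin T M" "M \<noteq> {}" "P M"
    "\<And>N. N \<subseteq> M \<Longrightarrow> closedin T N \<Longrightarrow> N \<noteq> {} \<Longrightarrow> P N \<Longrightarrow> N = M"
proof -
  define \<A> where "\<A> = {N. N \<subseteq> A \<and> closedin T N \<and> N \<noteq> {} \<and> P N}"
  have "\<exists>M\<in>\<A>. \<forall>N\<in>\<A>. M \<supseteq> N \<longrightarrow> N = M"
  proof (rule predicate_Zorn)
    show "partial_order_on \<A> (relation_of (\<lambda>M N. M \<supseteq> N) \<A>)"
      by (rule partial_order_on_relation_ofI) auto
    fix \<C> assume "\<C> \<in> Chains (relation_of (\<lambda>M N. M \<supseteq> N) \<A>)"
    then have sub: "\<C> \<subseteq> \<A>" and chain: "\<And>M N. M \<in> \<C> \<Longrightarrow> N \<in> \<C> \<Longrightarrow> M \<subseteq> N \<or> N \<subseteq> M"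
      by (auto simp: Chains_def relation_of_def)
    show "\<exists>u\<in>\<A>. \<forall>a\<in>\<C>. a \<supseteq> u"
    proof (cases "\<C> = {}")
      case True
      then show ?thesis
        using assms(2-4) by (auto simp: \<A>_def)
    next
      case False
      \<comment> \<open>A nonempty finite subfamily of a chain has a least member, which is its
        intersection.\<close>
      have "\<Inter>\<F> \<noteq> {}" if "finite \<F>" "\<F> \<subseteq> \<C>" for \<F>
      proof (cases "\<F> = {}")
        case False
        have "subset.chain UNIV \<F>"
          using that(2) chain unfolding subset.chain_def by blast
        then have "\<Inter>\<F> \<in> \<F>"
          using False that(1) Inter_in_chain by blast
        then have "\<Inter>\<F> \<in> \<A>"
          using that sub by blast
        then show ?thesis
          by (simp add: \<A>_def)
      qed simp
      moreover have "\<forall>C\<in>\<C>. closedin T C"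
        using sub by (auto simp: \<A>_def)
      ultimately have "\<Inter>\<C> \<noteq> {}"
        using \<open>compact_space T\<close> by (simp add: compact_space_fip)
      moreover have "closedin T (\<Inter>\<C>)"
        using False sub by (intro closedin_Inter) (auto simp: \<A>_def)
      moreover have "P (\<Inter>\<C>)"
        using False sub by (intro Inter) (auto simp: \<A>_def)
      moreover have "\<Inter>\<C> \<subseteq> A"
        using False sub by (fastforce simp: \<A>_def)
      ultimately have "\<Inter>\<C> \<in> \<A>"
        by (simp add: \<A>_def)
      then show ?thesis by blast
    qed
  qed
  then obtain M where M: "M \<in> \<A>" "\<And>N. N \<in> \<A> \<Longrightarrow> N \<subseteq> M \<Longrightarrow> N = M"
    by blast
  show thesis
  proof (rule that)
    show "N = M" if "N \<subseteq> M" "closedin T N" "N \<noteq> {}" "P N" for N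
      using that M(1) by (intro M(2)) (auto simp: \<A>_def)
  qed (use M(1) in \<open>simp_all add: \<A>_def\<close>)
qed

locale compact_right_topological_semigroup =
  fixes T :: "'b topology" and m :: "'b \<Rightarrow> 'b \<Rightarrow> 'b"
  assumes compact: "compact_space T"
    and Hausdorff: "Hausdorff_space T"
    and closed: "\<lbrakk>p \<in> topspace T; q \<in> topspace T\<rbrakk> \<Longrightarrow> m p q \<in> topspace T"
    and assoc: "\<lbrakk>p \<in> topspace T; q \<in> topspace T; r \<in> topspace T\<rbrakk> \<Longrightarrow> m (m p q) r = m p (m q r)"
    and continuous: "p \<in> topspace T \<Longrightarrow> continuous_map T T (\<lambda>q. m q p)"
begin

text \<open>A continuous map from a compact space to a Hausdorff space is closed. Only translations
  varying the left factor are assumed continuous, hence the order of \<open>q\<close> and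
  \<open>p\<close>.\<close>

lemma closedin_translate:
  assumes "closedin T A" "p \<in> topspace T"
  shows "closedin T ((\<lambda>q. m q p) ` A)"
  using continuous_imp_closed_map[OF continuous compact Hausdorff] assms
  by (simp add: closed_map_def)

text \<open>Let \<open>M\<close> be a minimal closed subsemigroup of \<open>A\<close> and
  \<open>p\<close> a point of it. Minimality is used twice: \<open>M p = M\<close> provides some
  \<open>r\<close> with \<open>r p = p\<close>, and then the elements of \<open>M\<close> that fix
  \<open>p\<close> from the left make up all of \<open>M\<close>, so \<open>p\<close> fixes
  itself.\<close>

theorem ellis_idempotent:
  assumes A: "closedin T A" "A \<noteq> {}" and mult: "\<And>p q. p \<in> A \<Longrightarrow> q \<in> A \<Longrightarrow> m p q \<in> A"
  obtains p where "p \<in> A" "m p p = p"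
proof -
  define P where "P B \<longleftrightarrow> (\<forall>p\<in>B. \<forall>q\<in>B. m p q \<in> B)" for B
  obtain M where M: "M \<subseteq> A" "closedin T M" "M \<noteq> {}" "P M"
    and min: "\<And>N. N \<subseteq> M \<Longrightarrow> closedin T N \<Longrightarrow> N \<noteq> {} \<Longrightarrow> P N \<Longrightarrow> N = M"
    by (rule compact_space_minimal_closed[OF compact A, of P]) (use mult in \<open>auto simp: P_def\<close>)
  obtain p where p: "p \<in> M" using M by blast
  have MT: "M \<subseteq> topspace T"
    using M closedin_subset by blast
  have Pm: "\<And>p q. p \<in> M \<Longrightarrow> q \<in> M \<Longrightarrow> m p q \<in> M"
    using M by (auto simp: P_def)
  have "(\<lambda>q. m q p) ` M = M"
  proof (rule min)
    show "P ((\<lambda>q. m q p) ` M)"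
      unfolding P_def
    proof (intro ballI)
      fix a b assume "a \<in> (\<lambda>q. m q p) ` M" "b \<in> (\<lambda>q. m q p) ` M"
      then obtain r s where rs: "a = m r p" "r \<in> M" "b = m s p" "s \<in> M" by auto
      then have "m a b = m (m (m r p) s) p"
        using p MT Pm by (simp add: assoc subset_iff)
      then show "m a b \<in> (\<lambda>q. m q p) ` M"
        using rs p Pm by blast
    qed
  qed (use M p MT Pm closedin_translate in auto)
  with p have "p \<in> (\<lambda>q. m q p) ` M"
    by blast
  then obtain r where r: "r \<in> M" "m r p = p"
    by (elim imageE) simp
  define N where "N = {q \<in> M. m q p = p}"
  \<comment> \<open>Singletons are closed in a Hausdorff space, so \<open>N\<close> is cut out of
    \<open>M\<close> by the continuous preimage of a closed set.\<close>
  have "closedin T {q \<in> topspace T. m q p \<in> {p}}"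
    using p MT continuous
    by (intro closedin_continuous_map_preimage) (auto simp: closedin_Hausdorff_singleton Hausdorff)
  moreover have "N = M \<inter> {q \<in> topspace T. m q p \<in> {p}}"
    using MT by (auto simp: N_def)
  ultimately have "closedin T N"
    using M by auto
  then have "N = M"
    by (rule min[rotated]) (use r p MT Pm in \<open>auto simp: N_def P_def assoc subset_iff\<close>)
  then show thesis
    using that p M by (auto simp: N_def)
qed

text \<open>A minimal closed left ideal \<open>M\<close> inside \<open>L\<close> contains an
  idempotent by Ellis' theorem. Since \<open>smallest_ideal\<close> is an intersection, it remains
  to see that \<open>M\<close> lies in every two-sided ideal \<open>J\<close>.\<close>

lemma closed_left_ideal_has_minimal_idempotent:
  assumes L: "closedin T L" "L \<noteq> {}" and ideal: "\<And>t l. t \<in> topspace T \<Longrightarrow> l \<in> L \<Longrightarrow> m t l \<in> L"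
  obtains p where "p \<in> L" "m p p = p" "p \<in> smallest_ideal (topspace T) m"
proof -
  define P where "P B \<longleftrightarrow> (\<forall>t\<in>topspace T. \<forall>l\<in>B. m t l \<in> B)" for B
  obtain M where M: "M \<subseteq> L" "closedin T M" "M \<noteq> {}" "P M"
    and min: "\<And>N. N \<subseteq> M \<Longrightarrow> closedin T N \<Longrightarrow> N \<noteq> {} \<Longrightarrow> P N \<Longrightarrow> N = M"
    by (rule compact_space_minimal_closed[OF compact L, of P]) (use ideal in \<open>auto simp: P_def\<close>)
  have MT: "M \<subseteq> topspace T"
    using M closedin_subset by blast
  obtain p where p: "p \<in> M" "m p p = p"
    by (rule ellis_idempotent[of M]) (use M MT in \<open>auto simp: P_def\<close>)
  have "M \<subseteq> J" if J: "two_sided_ideal (topspace T) m J" for J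
  proof -
    obtain j where j: "j \<in> J" "j \<in> topspace T"
      using J by (auto simp: two_sided_ideal_def)
    \<comment> \<open>A product of a point of \<open>J\<close> with a point of \<open>M\<close> lies
      in both.\<close>
    define l where "l = m j p"
    have l: "l \<in> M" "l \<in> J" "l \<in> topspace T"
      using p j M MT J by (auto simp: l_def P_def two_sided_ideal_def)
    \<comment> \<open>The multiples of \<open>l\<close> form a closed left ideal inside
      \<open>M\<close>, hence all of \<open>M\<close>; they also lie in \<open>J\<close>.\<close>
    have "(\<lambda>t. m t l) ` topspace T = M"
    proof (rule min)
      show "P ((\<lambda>t. m t l) ` topspace T)"
        unfolding P_def
      proof (intro ballI)
        fix t a assume "t \<in> topspace T" "a \<in> (\<lambda>t. m t l) ` topspace T"
        then obtain s where "s \<in> topspace T" "a = m s l" "t \<in> topspace T" by auto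
        then have "m t a = m (m t s) l" "m t s \<in> topspace T"
          using l by (auto simp: assoc closed)
        then show "m t a \<in> (\<lambda>t. m t l) ` topspace T" by blast
      qed
    qed (use l M closedin_translate in \<open>auto simp: P_def\<close>)
    moreover have "(\<lambda>t. m t l) ` topspace T \<subseteq> J"
      using J l by (auto simp: two_sided_ideal_def)
    ultimately show ?thesis by simp
  qed
  then have "p \<in> smallest_ideal (topspace T) m"
    using p by (auto simp: smallest_ideal_def)
  then show thesis
    using that p M by blast
qed

end

section \<open>Ultrafilters\<close>

lemma ultrafilter_on_subset: "\<lbrakk>ultrafilter_on S p; A \<in> p\<rbrakk> \<Longrightarrow> A \<subseteq> S"
  and ultrafilter_on_carrier: "ultrafilter_on S p \<Longrightarrow> S \<in> p"
  and ultrafilter_on_empty: "ultrafilter_on S p \<Longrightarrow> {} \<notin> p"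
  and ultrafilter_on_mono: "\<lbrakk>ultrafilter_on S p; A \<in> p; A \<subseteq> B; B \<subseteq> S\<rbrakk> \<Longrightarrow> B \<in> p"
  unfolding ultrafilter_on_def by blast+

lemma ultrafilter_on_Int_iff:
  assumes "ultrafilter_on S p" "A \<subseteq> S" "B \<subseteq> S"
  shows "A \<inter> B \<in> p \<longleftrightarrow> A \<in> p \<and> B \<in> p"
  using assms unfolding ultrafilter_on_def by (metis inf_le1 inf_le2)

lemma ultrafilter_on_Diff_iff:
  assumes "ultrafilter_on S p" "A \<subseteq> S"
  shows "S - A \<in> p \<longleftrightarrow> A \<notin> p"
  using assms unfolding ultrafilter_on_def by (metis Diff_disjoint)

text \<open>The two equivalences say that membership in \<open>p\<close> is a Boolean homomorphism,
  a property that passes directly to families defined by preimages, such as pushforwards and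
  products.\<close>

lemma ultrafilter_onI:
  assumes "p \<subseteq> Pow S" "S \<in> p"
    and "\<And>A B. A \<subseteq> S \<Longrightarrow> B \<subseteq> S \<Longrightarrow> A \<inter> B \<in> p \<longleftrightarrow> A \<in> p \<and> B \<in> p"
    and "\<And>A. A \<subseteq> S \<Longrightarrow> S - A \<in> p \<longleftrightarrow> A \<notin> p"
  shows "ultrafilter_on S p"
  unfolding ultrafilter_on_def
proof (intro conjI ballI allI impI)
  show "{} \<notin> p"
    using assms(2) assms(4)[of S] by auto
  show "A \<inter> B \<in> p" if "A \<in> p" "B \<in> p" for A B
    using assms(1,3) that by blast
  show "B \<in> p" if "A \<in> p" "A \<subseteq> B \<and> B \<subseteq> S" for A B
    using assms(3)[of A B] that by (metis inf.absorb1 order_trans)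
qed (use assms in auto)

text \<open>Ultrafilters are maximal: a set in \<open>q\<close> but not in \<open>p\<close> would
  have its complement in \<open>p\<close>, hence in \<open>q\<close>.\<close>

lemma ultrafilter_on_eqI:
  assumes p: "ultrafilter_on S p" and q: "ultrafilter_on S q" and "p \<subseteq> q"
  shows "p = q"
proof
  show "q \<subseteq> p"
  proof
    fix A assume A: "A \<in> q"
    then have "A \<subseteq> S" using q ultrafilter_on_subset by blast
    then show "A \<in> p"
      using ultrafilter_on_Diff_iff[OF p] ultrafilter_on_Diff_iff[OF q] A \<open>p \<subseteq> q\<close> by blast
  qed
qed fact

text \<open>The intersection with \<open>S\<close> is there for empty \<open>\<F>\<close>, where
  \<open>\<Inter>\<F>\<close> is \<open>UNIV\<close>.\<close>

lemma ultrafilter_on_Inter: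
  assumes "ultrafilter_on S p" "finite \<F>" "\<F> \<subseteq> p"
  shows "S \<inter> \<Inter>\<F> \<in> p"
  using assms(2,3)
proof (induction \<F>)
  case empty
  then show ?case using ultrafilter_on_carrier[OF assms(1)] by simp
next
  case (insert A \<F>)
  then have "A \<inter> (S \<inter> \<Inter>\<F>) \<in> p"
    using ultrafilter_on_Int_iff[OF assms(1)] ultrafilter_on_subset[OF assms(1)] by auto
  then show ?case by (simp add: Int_left_commute)
qed

text \<open>Otherwise the finitely many complements would all be in \<open>p\<close>, but their
  intersection within \<open>S\<close> is empty.\<close>

lemma ultrafilter_on_finite_cover:
  assumes p: "ultrafilter_on S p" and "finite P" "\<Union>P = S"
  obtains A where "A \<in> P" "A \<in> p"
proof -
  have "\<exists>A\<in>P. A \<in> p"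
  proof (rule ccontr)
    assume "\<not> ?thesis"
    then have "(\<lambda>A. S - A) ` P \<subseteq> p"
      using ultrafilter_on_Diff_iff[OF p] assms(3) by auto
    then have "S \<inter> \<Inter>((\<lambda>A. S - A) ` P) \<in> p"
      using assms(2) by (intro ultrafilter_on_Inter[OF p]) auto
    moreover have "S \<inter> \<Inter>((\<lambda>A. S - A) ` P) = {}"
      using assms(3) by auto
    ultimately show False
      using ultrafilter_on_empty[OF p] by simp
  qed
  then show thesis using that by blast
qed

text \<open>Zorn's lemma yields a maximal family with the finite intersection property that includes
  \<open>\<G>\<close>; maximality makes it an ultrafilter.\<close>

theorem ultrafilter_on_extends:
  assumes "\<G> \<subseteq> Pow S" and fip: "\<And>\<F>. finite \<F> \<Longrightarrow> \<F> \<subseteq> \<G> \<Longrightarrow> S \<inter> \<Inter>\<F> \<noteq> {}"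
  obtains p where "ultrafilter_on S p" "\<G> \<subseteq> p"
proof -
  define FIP where "FIP \<H> \<longleftrightarrow> (\<forall>\<F>. finite \<F> \<and> \<F> \<subseteq> \<H> \<longrightarrow> S \<inter> \<Inter>\<F> \<noteq> {})" for \<H>
  define \<A> where "\<A> = {\<H>. \<G> \<subseteq> \<H> \<and> \<H> \<subseteq> Pow S \<and> FIP \<H>}"
  have "\<exists>M\<in>\<A>. \<forall>T\<in>\<A>. M \<subseteq> T \<longrightarrow> T = M"
  proof (rule subset_Zorn_nonempty)
    have "\<G> \<in> \<A>"
      using assms(1) by (simp add: \<A>_def FIP_def fip)
    then show "\<A> \<noteq> {}" by blast
    fix \<C> assume C: "\<C> \<noteq> {}" "subset.chain \<A> \<C>"
    have "FIP (\<Union>\<C>)"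
      unfolding FIP_def
    proof (intro allI impI, elim conjE)
      fix \<F> assume "finite \<F>" "\<F> \<subseteq> \<Union>\<C>"
      then obtain \<H> where "\<H> \<in> \<C>" "\<F> \<subseteq> \<H>"
        by (rule finite_subset_Union_chain) (use C in auto)
      then show "S \<inter> \<Inter>\<F> \<noteq> {}"
        using C \<open>finite \<F>\<close> by (auto simp: subset.chain_def \<A>_def FIP_def)
    qed
    moreover have "\<C> \<subseteq> \<A>"
      using C by (simp add: subset.chain_def)
    ultimately show "\<Union>\<C> \<in> \<A>"
      using \<open>\<C> \<noteq> {}\<close> unfolding \<A>_def by blast
  qed
  then obtain p where "p \<in> \<A>" and max\<A>: "\<forall>\<H>\<in>\<A>. p \<subseteq> \<H> \<longrightarrow> \<H> = p"
    by blast
  then have p: "\<G> \<subseteq> p" "p \<subseteq> Pow S" "FIP p"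
    by (simp_all add: \<A>_def)
  have max: "\<H> = p" if "p \<subseteq> \<H>" "\<H> \<subseteq> Pow S" "FIP \<H>" for \<H>
    using max\<A> that p(1) by (simp add: \<A>_def)
  \<comment> \<open>By maximality, adjoining \<open>A\<close> destroys the finite intersection
    property, and a finite subfamily of \<open>p\<close> witnesses this.\<close>
  have notin: "\<exists>\<F>. finite \<F> \<and> \<F> \<subseteq> p \<and> S \<inter> A \<inter> \<Inter>\<F> = {}" if A: "A \<subseteq> S" "A \<notin> p" for A
  proof -
    have "\<not> FIP (insert A p)"
      using max[of "insert A p"] A p by auto
    then obtain \<F> where "finite \<F>" "\<F> \<subseteq> insert A p" "S \<inter> \<Inter>\<F> = {}"
      by (auto simp: FIP_def)
    then show ?thesis
      by (intro exI[of _ "\<F> - {A}"]) auto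
  qed
  \<comment> \<open>\<open>p\<close> contains every set that includes a finite intersection of its
    members: a finite subfamily avoiding \<open>A\<close> would combine with \<open>\<F>\<close> to
    an empty intersection.\<close>
  have mem: "A \<in> p" if F: "A \<subseteq> S" "finite \<F>" "\<F> \<subseteq> p" "S \<inter> \<Inter>\<F> \<subseteq> A" for A \<F>
  proof (rule ccontr)
    assume "A \<notin> p"
    then obtain \<F>' where F': "finite \<F>'" "\<F>' \<subseteq> p" "S \<inter> A \<inter> \<Inter>\<F>' = {}"
      using notin[OF F(1)] by blast
    have "S \<inter> \<Inter>(\<F> \<union> \<F>') \<noteq> {}"
      using \<open>FIP p\<close> F(2,3) F'(1,2) by (simp add: FIP_def)
    moreover have "S \<inter> \<Inter>(\<F> \<union> \<F>') \<subseteq> S \<inter> A \<inter> \<Inter>\<F>'"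
      using F(4) by blast
    ultimately show False
      using F'(3) by simp
  qed
  have "ultrafilter_on S p"
  proof (rule ultrafilter_onI)
    show "S \<in> p"
      by (rule mem[of _ "{}"]) auto
    show "A \<inter> B \<in> p \<longleftrightarrow> A \<in> p \<and> B \<in> p" if "A \<subseteq> S" "B \<subseteq> S" for A B
      using that mem[of A "{A \<inter> B}"] mem[of B "{A \<inter> B}"] mem[of "A \<inter> B" "{A,B}"] by auto
    show "S - A \<in> p \<longleftrightarrow> A \<notin> p" if A: "A \<subseteq> S" for A
    proof
      assume "S - A \<in> p"
      then show "A \<notin> p"
        using \<open>FIP p\<close>[unfolded FIP_def, rule_format, of "{A, S - A}"] by auto
    next
      assume "A \<notin> p"
      then obtain \<F> where "finite \<F>" "\<F> \<subseteq> p" "S \<inter> A \<inter> \<Inter>\<F> = {}"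
        using notin[OF A] by blast
      then show "S - A \<in> p"
        using mem[of "S - A" \<F>] by auto
    qed
  qed (use p in auto)
  then show thesis using that p by blast
qed

section \<open>Principal ultrafilters, restrictions and images\<close>

definition principal_ultrafilter :: "'a set \<Rightarrow> 'a \<Rightarrow> 'a set set" where
  "principal_ultrafilter S x = {A. A \<subseteq> S \<and> x \<in> A}"

lemma ultrafilter_on_principal: "x \<in> S \<Longrightarrow> ultrafilter_on S (principal_ultrafilter S x)"
  unfolding ultrafilter_on_def principal_ultrafilter_def by auto

text \<open>Used to pass from an ultrafilter on a ring to one on its nonzero elements.\<close>

lemma ultrafilter_on_restrict:
  assumes p: "ultrafilter_on S p" and "T \<in> p"
  shows "ultrafilter_on T {A \<in> p. A \<subseteq> T}"
proof (rule ultrafilter_onI)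
  have T: "T \<subseteq> S" using assms ultrafilter_on_subset by blast
  show "A \<inter> B \<in> {A \<in> p. A \<subseteq> T} \<longleftrightarrow> A \<in> {A \<in> p. A \<subseteq> T} \<and> B \<in> {A \<in> p. A \<subseteq> T}"
    if "A \<subseteq> T" "B \<subseteq> T" for A B
    using that T ultrafilter_on_Int_iff[OF p, of A B] by blast
  show "T - A \<in> {A \<in> p. A \<subseteq> T} \<longleftrightarrow> A \<notin> {A \<in> p. A \<subseteq> T}" if "A \<subseteq> T" for A
  proof -
    have "T - A = T \<inter> (S - A)" using T by blast
    then have "T - A \<in> p \<longleftrightarrow> S - A \<in> p"
      using T ultrafilter_on_Int_iff[OF p, of T "S - A"] \<open>T \<in> p\<close> by auto
    also have "\<dots> \<longleftrightarrow> A \<notin> p"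
      using that T ultrafilter_on_Diff_iff[OF p, of A] by blast
    finally show ?thesis using that by blast
  qed
qed (use assms in auto)

text \<open>For \<open>h\<close> mapping \<open>S\<close> into \<open>T\<close>, this is the value
  at \<open>p\<close> of the continuous extension of \<open>h\<close> to the Stone-Cech
  compactifications.\<close>

definition pushforward :: "'a set \<Rightarrow> 'b set \<Rightarrow> ('a \<Rightarrow> 'b) \<Rightarrow> 'a set set \<Rightarrow> 'b set set" where
  "pushforward S T h p = {B. B \<subseteq> T \<and> {x \<in> S. h x \<in> B} \<in> p}"

lemma ultrafilter_on_pushforward:
  assumes "ultrafilter_on S p" "h ` S \<subseteq> T"
  shows "ultrafilter_on T (pushforward S T h p)"
proof (rule ultrafilter_onI)
  show "T \<in> pushforward S T h p"
    using assms ultrafilter_on_carrier[OF assms(1)]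
    by (auto simp: pushforward_def image_subset_iff Collect_conj_eq Int_absorb2 subset_iff cong: conj_cong)
  show "A \<inter> B \<in> pushforward S T h p \<longleftrightarrow> A \<in> pushforward S T h p \<and> B \<in> pushforward S T h p"
    if "A \<subseteq> T" "B \<subseteq> T" for A B
  proof -
    have "{x \<in> S. h x \<in> A \<inter> B} = {x \<in> S. h x \<in> A} \<inter> {x \<in> S. h x \<in> B}" by auto
    then show ?thesis
      using that ultrafilter_on_Int_iff[OF assms(1), of "{x \<in> S. h x \<in> A}" "{x \<in> S. h x \<in> B}"]
      by (auto simp: pushforward_def)
  qed
  show "T - A \<in> pushforward S T h p \<longleftrightarrow> A \<notin> pushforward S T h p" if "A \<subseteq> T" for A
  proof -
    have "{x \<in> S. h x \<in> T - A} = S - {x \<in> S. h x \<in> A}" using assms by auto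
    then show ?thesis
      using that ultrafilter_on_Diff_iff[OF assms(1), of "{x \<in> S. h x \<in> A}"]
      by (auto simp: pushforward_def)
  qed
qed (auto simp: pushforward_def)

text \<open>The preimages of members of \<open>j\<close> have the finite intersection property,
  because finite intersections of members of \<open>j\<close> meet the image of \<open>h\<close>. An
  ultrafilter containing these preimages is mapped to \<open>j\<close>.\<close>

lemma pushforward_surj:
  assumes j: "ultrafilter_on T j" and h: "h ` S \<subseteq> T" "h ` S \<in> j"
  obtains q where "ultrafilter_on S q" "pushforward S T h q = j"
proof -
  obtain q where q: "ultrafilter_on S q" "(\<lambda>B. {x \<in> S. h x \<in> B}) ` j \<subseteq> q"
  proof (rule ultrafilter_on_extends)
    show "(\<lambda>B. {x \<in> S. h x \<in> B}) ` j \<subseteq> Pow S" by auto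
    fix \<F> assume "finite \<F>" "\<F> \<subseteq> (\<lambda>B. {x \<in> S. h x \<in> B}) ` j"
    then obtain \<B> where B: "\<B> \<subseteq> j" "finite \<B>" "\<F> = (\<lambda>B. {x \<in> S. h x \<in> B}) ` \<B>"
      by (meson finite_subset_image)
    \<comment> \<open>With the image of \<open>h\<close> included, a common point has the form
      \<open>h x\<close> with \<open>x\<close> in \<open>S\<close>, and this \<open>x\<close> lies
      in every set of \<open>\<F>\<close>.\<close>
    then have "T \<inter> \<Inter>(insert (h ` S) \<B>) \<in> j"
      using h by (intro ultrafilter_on_Inter[OF j]) auto
    then have "T \<inter> \<Inter>(insert (h ` S) \<B>) \<noteq> {}"
      using ultrafilter_on_empty[OF j] by metis
    then show "S \<inter> \<Inter>\<F> \<noteq> {}"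
      by (auto simp: B)
  qed
  then have "j \<subseteq> pushforward S T h q"
    using ultrafilter_on_subset[OF j] by (auto simp: pushforward_def)
  then have "pushforward S T h q = j"
    using ultrafilter_on_eqI[OF j ultrafilter_on_pushforward[OF q(1) h(1)]] by simp
  then show thesis using that q by blast
qed

section \<open>The semigroup of ultrafilters\<close>

text \<open>The sets of all ultrafilters containing a given \<open>A\<close> form a base; the
  predicate says directly that \<open>U\<close> is a union of such sets.\<close>

definition stone_topology :: "'a set \<Rightarrow> 'a set set topology" where
  "stone_topology S = topology (\<lambda>U. U \<subseteq> {p. ultrafilter_on S p} \<and>
     (\<forall>p\<in>U. \<exists>A\<in>p. \<forall>q. ultrafilter_on S q \<and> A \<in> q \<longrightarrow> q \<in> U))"

lemma openin_stone_topology: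
  "openin (stone_topology S) U \<longleftrightarrow> U \<subseteq> {p. ultrafilter_on S p} \<and>
     (\<forall>p\<in>U. \<exists>A\<in>p. \<forall>q. ultrafilter_on S q \<and> A \<in> q \<longrightarrow> q \<in> U)"
proof -
  have "istopology (\<lambda>U. U \<subseteq> {p. ultrafilter_on S p} \<and>
     (\<forall>p\<in>U. \<exists>A\<in>p. \<forall>q. ultrafilter_on S q \<and> A \<in> q \<longrightarrow> q \<in> U))" (is "istopology ?O")
    unfolding istopology_def
  proof (intro conjI allI impI)
    fix U V assume U: "?O U" and V: "?O V"
    show "\<forall>p\<in>U \<inter> V. \<exists>A\<in>p. \<forall>q. ultrafilter_on S q \<and> A \<in> q \<longrightarrow> q \<in> U \<inter> V"
    proof
      fix p assume p: "p \<in> U \<inter> V"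
      obtain A where A: "A \<in> p" "\<forall>q. ultrafilter_on S q \<and> A \<in> q \<longrightarrow> q \<in> U"
        using U p by blast
      obtain B where B: "B \<in> p" "\<forall>q. ultrafilter_on S q \<and> B \<in> q \<longrightarrow> q \<in> V"
        using V p by blast
      have up: "ultrafilter_on S p" using p U by blast
      then have sub: "A \<subseteq> S" "B \<subseteq> S" using A B ultrafilter_on_subset by blast+
      show "\<exists>A\<in>p. \<forall>q. ultrafilter_on S q \<and> A \<in> q \<longrightarrow> q \<in> U \<inter> V"
        using A B up by (intro bexI[of _ "A \<inter> B"]) (auto simp: ultrafilter_on_Int_iff sub)
    qed
  next
    fix \<K> assume "\<forall>K\<in>\<K>. ?O K"
    then show "\<forall>p\<in>\<Union>\<K>. \<exists>A\<in>p. \<forall>q. ultrafilter_on S q \<and> A \<in> q \<longrightarrow> q \<in> \<Union>\<K>"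
      by (meson Union_iff)
  qed auto
  then show ?thesis
    by (simp add: stone_topology_def topology_inverse')
qed

lemma openin_stone_topology_basic: "openin (stone_topology S) {p. ultrafilter_on S p \<and> A \<in> p}"
  unfolding openin_stone_topology by blast

lemma topspace_stone_topology [simp]: "topspace (stone_topology S) = {p. ultrafilter_on S p}"
proof -
  have "openin (stone_topology S) {p. ultrafilter_on S p}"
    unfolding openin_stone_topology using ultrafilter_on_carrier by blast
  then show ?thesis
    by (metis openin_stone_topology openin_subset openin_topspace subset_antisym)
qed

text \<open>The inner condition says that every basic neighbourhood of \<open>p\<close> meets
  \<open>C\<close>, that is, \<open>p\<close> is in the closure of \<open>C\<close>.\<close>

lemma closedin_stone_topologyI:
  assumes "\<And>p. p \<in> C \<Longrightarrow> ultrafilter_on S p"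
    and "\<And>p. ultrafilter_on S p \<Longrightarrow> (\<And>A. A \<in> p \<Longrightarrow> \<exists>q\<in>C. A \<in> q) \<Longrightarrow> p \<in> C"
  shows "closedin (stone_topology S) C"
  unfolding closedin_def openin_stone_topology topspace_stone_topology
proof (intro conjI ballI)
  fix p assume p: "p \<in> {p. ultrafilter_on S p} - C"
  then obtain A where "A \<in> p" "\<forall>q\<in>C. A \<notin> q"
    using assms(2)[of p] by blast
  then show "\<exists>A\<in>p. \<forall>q. ultrafilter_on S q \<and> A \<in> q \<longrightarrow> q \<in> {p. ultrafilter_on S p} - C"
    by blast
qed (use assms(1) in auto)

text \<open>A point common to all of \<open>\<U>\<close> must contain each set that belongs to all
  points of a single \<open>U\<close>; these sets form \<open>\<G>\<close>. Conversely, any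
  ultrafilter \<open>p\<close> including \<open>\<G>\<close> is such a point: if a set
  \<open>A\<close> in \<open>p\<close> gave a basic neighbourhood missing \<open>U\<close>, then
  \<open>S - A\<close> would be in \<open>\<G>\<close>.\<close>

lemma compact_stone_topology: "compact_space (stone_topology S)"
  unfolding compact_space_fip
proof (intro allI impI, elim conjE)
  fix \<U> assume cl: "\<forall>C\<in>\<U>. closedin (stone_topology S) C"
    and fip: "\<forall>\<F>. finite \<F> \<and> \<F> \<subseteq> \<U> \<longrightarrow> \<Inter>\<F> \<noteq> {}"
  show "\<Inter>\<U> \<noteq> {}"
  proof (cases "\<U> = {}")
    case False
    define \<G> where "\<G> = {A. A \<subseteq> S \<and> (\<exists>U\<in>\<U>. \<forall>p\<in>U. A \<in> p)}"
    obtain p where p: "ultrafilter_on S p" "\<G> \<subseteq> p"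
    proof (rule ultrafilter_on_extends)
      show "\<G> \<subseteq> Pow S" by (auto simp: \<G>_def)
      fix \<F> assume F: "finite \<F>" "\<F> \<subseteq> \<G>"
      then have "\<forall>A\<in>\<F>. \<exists>U. U \<in> \<U> \<and> (\<forall>p\<in>U. A \<in> p)"
        by (auto simp: \<G>_def)
      then obtain u where u: "\<forall>A\<in>\<F>. u A \<in> \<U> \<and> (\<forall>p\<in>u A. A \<in> p)"
        by (rule bchoice[THEN exE])
      obtain V where V: "V \<in> \<U>" using False by blast
      \<comment> \<open>The extra \<open>V\<close> guarantees that the common point is an
        ultrafilter even if \<open>\<F>\<close> is empty.\<close>
      have "\<Inter>(insert V (u ` \<F>)) \<noteq> {}"
        using V u F(1) by (intro fip[rule_format]) auto
      then obtain q where q: "q \<in> V" "\<forall>A\<in>\<F>. q \<in> u A" by auto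
      have "V \<subseteq> {p. ultrafilter_on S p}"
        using cl V closedin_subset by fastforce
      then have q: "ultrafilter_on S q" "\<F> \<subseteq> q"
        using u q by auto
      then show "S \<inter> \<Inter>\<F> \<noteq> {}"
        using ultrafilter_on_Inter[OF q(1) F(1)] ultrafilter_on_empty[OF q(1)] by metis
    qed
    have "p \<in> U" if U: "U \<in> \<U>" for U
    proof (rule ccontr)
      assume "p \<notin> U"
      then have pU: "p \<in> {p. ultrafilter_on S p} - U" using p by blast
      have "closedin (stone_topology S) U" using cl U by blast
      then have op: "openin (stone_topology S) ({p. ultrafilter_on S p} - U)"
        and sub: "U \<subseteq> {p. ultrafilter_on S p}"
        by (simp_all add: closedin_def)
      have "\<exists>A\<in>p. \<forall>q. ultrafilter_on S q \<and> A \<in> q \<longrightarrow> q \<in> {p. ultrafilter_on S p} - U"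
        using op pU unfolding openin_stone_topology by simp
      then obtain A where A: "A \<in> p" "\<forall>q. ultrafilter_on S q \<and> A \<in> q \<longrightarrow> q \<notin> U"
        by blast
      have "A \<subseteq> S" using A p ultrafilter_on_subset by blast
      then have "\<forall>q\<in>U. S - A \<in> q"
        using A sub ultrafilter_on_Diff_iff by blast
      then have "S - A \<in> \<G>"
        using U by (auto simp: \<G>_def)
      then have "S - A \<in> p"
        using p(2) by blast
      then show False
        using A p \<open>A \<subseteq> S\<close> ultrafilter_on_Diff_iff by blast
    qed
    then show ?thesis by blast
  qed simp
qed

lemma Hausdorff_stone_topology: "Hausdorff_space (stone_topology S)"
  unfolding Hausdorff_space_def
proof (intro allI impI, elim conjE)
  fix p q assume "p \<in> topspace (stone_topology S)" "q \<in> topspace (stone_topology S)" "p \<noteq> q"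
  then have p: "ultrafilter_on S p" and q: "ultrafilter_on S q" and "\<not> p \<subseteq> q"
    using ultrafilter_on_eqI by auto
  then obtain A where A: "A \<in> p" "A \<notin> q" by blast
  then have AS: "A \<subseteq> S" using p ultrafilter_on_subset by blast
  let ?U = "\<lambda>A. {p. ultrafilter_on S p \<and> A \<in> p}"
  have "disjnt (?U A) (?U (S - A))"
    using AS ultrafilter_on_Diff_iff by (auto simp: disjnt_iff)
  then show "\<exists>U V. openin (stone_topology S) U \<and> openin (stone_topology S) V \<and> p \<in> U \<and> q \<in> V \<and> disjnt U V"
    using p q A AS ultrafilter_on_Diff_iff
    by (intro exI[of _ "?U A"] exI[of _ "?U (S - A)"]) (auto simp: openin_stone_topology_basic)
qed

lemma left_preimage_subset: "left_preimage S x A \<subseteq> carrier S"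
  by (auto simp: left_preimage_def)

section \<open>The product of ultrafilters\<close>

context monoid
begin

lemma beta_mult_closed:
  assumes p: "ultrafilter_on (carrier G) p" and q: "ultrafilter_on (carrier G) q"
  shows "ultrafilter_on (carrier G) (beta_mult G p q)"
proof (rule ultrafilter_onI)
  have "{x \<in> carrier G. left_preimage G x (carrier G) \<in> q} = carrier G"
    using ultrafilter_on_carrier[OF q] by (auto simp: left_preimage_def cong: conj_cong)
  then show "carrier G \<in> beta_mult G p q"
    using ultrafilter_on_carrier[OF p] by (simp add: beta_mult_def)
  show "A \<inter> B \<in> beta_mult G p q \<longleftrightarrow> A \<in> beta_mult G p q \<and> B \<in> beta_mult G p q"
    if "A \<subseteq> carrier G" "B \<subseteq> carrier G" for A B
  proof -
    have "left_preimage G x (A \<inter> B) = left_preimage G x A \<inter> left_preimage G x B" for x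
      by (auto simp: left_preimage_def)
    then have "{x \<in> carrier G. left_preimage G x (A \<inter> B) \<in> q} =
        {x \<in> carrier G. left_preimage G x A \<in> q} \<inter> {x \<in> carrier G. left_preimage G x B \<in> q}"
      using ultrafilter_on_Int_iff[OF q left_preimage_subset left_preimage_subset] by auto
    then show ?thesis
      using that ultrafilter_on_Int_iff[OF p, of "{x \<in> carrier G. left_preimage G x A \<in> q}"
          "{x \<in> carrier G. left_preimage G x B \<in> q}"]
      by (auto simp: beta_mult_def)
  qed
  show "carrier G - A \<in> beta_mult G p q \<longleftrightarrow> A \<notin> beta_mult G p q" if "A \<subseteq> carrier G" for A
  proof -
    have "left_preimage G x (carrier G - A) = carrier G - left_preimage G x A" if "x \<in> carrier G" for x
      using that by (auto simp: left_preimage_def)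
    then have "{x \<in> carrier G. left_preimage G x (carrier G - A) \<in> q} =
        carrier G - {x \<in> carrier G. left_preimage G x A \<in> q}"
      using ultrafilter_on_Diff_iff[OF q left_preimage_subset] by auto
    then show ?thesis
      using that ultrafilter_on_Diff_iff[OF p, of "{x \<in> carrier G. left_preimage G x A \<in> q}"]
      by (auto simp: beta_mult_def)
  qed
qed (auto simp: beta_mult_def)

text \<open>Preimages under translations compose in reverse order:
  \<open>(x y)^-1 A = y^-1 (x^-1 A)\<close>.\<close>

lemma beta_mult_assoc: "beta_mult G (beta_mult G p q) r = beta_mult G p (beta_mult G q r)"
proof -
  have "left_preimage G x {y \<in> carrier G. left_preimage G y A \<in> r} =
      {y \<in> carrier G. left_preimage G y (left_preimage G x A) \<in> r}" if "x \<in> carrier G" for x A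
  proof -
    have "left_preimage G (x \<otimes> y) A = left_preimage G y (left_preimage G x A)" if "y \<in> carrier G" for y
      using that \<open>x \<in> carrier G\<close> by (auto simp: left_preimage_def m_assoc)
    then show ?thesis
      using that by (auto simp: left_preimage_def[of G x])
  qed
  then show ?thesis
    by (auto simp: beta_mult_def left_preimage_subset cong: conj_cong)
qed

sublocale beta: compact_right_topological_semigroup "stone_topology (carrier G)" "beta_mult G"
proof
  fix p assume "p \<in> topspace (stone_topology (carrier G))"
  then have p: "ultrafilter_on (carrier G) p" by simp
  \<comment> \<open>A subset \<open>A\<close> is in the product of \<open>q\<close> and
    \<open>p\<close> exactly when the set of \<open>x\<close> with \<open>x^-1 A\<close> in
    \<open>p\<close> is in \<open>q\<close>, so preimages of basic open sets are basic open.\<close>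
  show "continuous_map (stone_topology (carrier G)) (stone_topology (carrier G)) (\<lambda>q. beta_mult G q p)"
    unfolding continuous_map
  proof (intro conjI allI impI)
    fix U assume U: "openin (stone_topology (carrier G)) U"
    show "openin (stone_topology (carrier G)) {q \<in> topspace (stone_topology (carrier G)). beta_mult G q p \<in> U}"
      unfolding openin_stone_topology
    proof (intro conjI ballI)
      fix q assume "q \<in> {q \<in> topspace (stone_topology (carrier G)). beta_mult G q p \<in> U}"
      then have q: "ultrafilter_on (carrier G) q" "beta_mult G q p \<in> U" by auto
      then obtain A where A: "A \<in> beta_mult G q p" "\<forall>r. ultrafilter_on (carrier G) r \<and> A \<in> r \<longrightarrow> r \<in> U"
        using U unfolding openin_stone_topology by blast
      then have AG: "A \<subseteq> carrier G" "{x \<in> carrier G. left_preimage G x A \<in> p} \<in> q"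
        by (auto simp: beta_mult_def)
      then have "A \<in> beta_mult G r p" if "{x \<in> carrier G. left_preimage G x A \<in> p} \<in> r" for r
        using that by (simp add: beta_mult_def)
      then show "\<exists>A\<in>q. \<forall>r. ultrafilter_on (carrier G) r \<and> A \<in> r \<longrightarrow>
          r \<in> {q \<in> topspace (stone_topology (carrier G)). beta_mult G q p \<in> U}"
        using AG A(2) beta_mult_closed[OF _ p]
        by (intro bexI[of _ "{x \<in> carrier G. left_preimage G x A \<in> p}"]) auto
    qed auto
  qed (use p beta_mult_closed in auto)
qed (simp_all add: compact_stone_topology Hausdorff_stone_topology beta_mult_closed beta_mult_assoc)

lemma closed_left_ideal_has_minimal_idempotent:
  assumes "closedin (stone_topology (carrier G)) L" "L \<noteq> {}"
    and "\<And>t l. t \<in> stone_cech G \<Longrightarrow> l \<in> L \<Longrightarrow> beta_mult G t l \<in> L"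
  obtains p where "p \<in> L" "minimal_idempotent G p"
proof -
  obtain p where "p \<in> L" "beta_mult G p p = p"
    "p \<in> smallest_ideal (topspace (stone_topology (carrier G))) (beta_mult G)"
    using beta.closed_left_ideal_has_minimal_idempotent[of L] assms by (auto simp: stone_cech_def)
  moreover have "p \<in> stone_cech G"
    using \<open>p \<in> L\<close> closedin_subset[OF assms(1)] by (auto simp: stone_cech_def)
  ultimately have "minimal_idempotent G p"
    by (simp add: minimal_idempotent_def stone_cech_def)
  then show thesis
    using that \<open>p \<in> L\<close> by blast
qed

lemma exists_minimal_idempotent: obtains p where "minimal_idempotent G p"
proof (rule closed_left_ideal_has_minimal_idempotent)
  show "closedin (stone_topology (carrier G)) (stone_cech G)"
    by (metis closedin_topspace stone_cech_def topspace_stone_topology)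
  show "stone_cech G \<noteq> {}"
    using ultrafilter_on_principal[OF one_closed] by (auto simp: stone_cech_def)
qed (auto simp: stone_cech_def beta_mult_closed)

end

section \<open>Minimal idempotents, ideals and homomorphisms\<close>

lemma minimal_idempotentD:
  assumes "minimal_idempotent S p"
  shows "ultrafilter_on (carrier S) p"
  using assms by (simp add: minimal_idempotent_def stone_cech_def)

text \<open>Minimality is exploited below by exhibiting a suitable two-sided ideal \<open>J\<close>
  of ultrafilters.\<close>

lemma minimal_idempotent_mem_ideal:
  assumes "minimal_idempotent S p" "two_sided_ideal (stone_cech S) (beta_mult S) J"
  shows "p \<in> J"
  using assms by (auto simp: minimal_idempotent_def smallest_ideal_def)

lemma central_mono:
  assumes "central S A" "A \<subseteq> B" "B \<subseteq> carrier S"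
  shows "central S B"
  using assms ultrafilter_on_mono minimal_idempotentD unfolding central_def by meson

lemma two_sided_idealI:
  assumes "I \<subseteq> T" "I \<noteq> {}"
    and "\<And>t i. t \<in> T \<Longrightarrow> i \<in> I \<Longrightarrow> m t i \<in> I" "\<And>t i. t \<in> T \<Longrightarrow> i \<in> I \<Longrightarrow> m i t \<in> I"
  shows "two_sided_ideal T m I"
  using assms by (simp add: two_sided_ideal_def)

lemma two_sided_idealD:
  assumes "two_sided_ideal T m I"
  shows "I \<subseteq> T" "I \<noteq> {}"
    and "\<And>t i. t \<in> T \<Longrightarrow> i \<in> I \<Longrightarrow> m t i \<in> I" "\<And>t i. t \<in> T \<Longrightarrow> i \<in> I \<Longrightarrow> m i t \<in> I"
  using assms by (simp_all add: two_sided_ideal_def)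

text \<open>The ultrafilters containing \<open>A\<close> form a two-sided ideal:
  \<open>x^-1 A\<close> includes \<open>A\<close> for every \<open>x\<close>, and is the whole
  monoid when \<open>x\<close> is in \<open>A\<close>.\<close>

lemma (in monoid) ideal_mem_minimal_idempotent:
  assumes p: "minimal_idempotent G p" and A: "two_sided_ideal (carrier G) (\<otimes>) A"
  shows "A \<in> p"
proof -
  note A = two_sided_idealD[OF A]
  have "two_sided_ideal (stone_cech G) (beta_mult G) {q \<in> stone_cech G. A \<in> q}"
  proof (rule two_sided_idealI)
    obtain a where "a \<in> A" "a \<in> carrier G" using A by blast
    then have "principal_ultrafilter (carrier G) a \<in> {q \<in> stone_cech G. A \<in> q}"
      using A(1) by (simp add: stone_cech_def ultrafilter_on_principal) (simp add: principal_ultrafilter_def)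
    then show "{q \<in> stone_cech G. A \<in> q} \<noteq> {}" by blast
  next
    fix t i assume t: "t \<in> stone_cech G" and i: "i \<in> {q \<in> stone_cech G. A \<in> q}"
    then have ut: "ultrafilter_on (carrier G) t" and ui: "ultrafilter_on (carrier G) i" and Ai: "A \<in> i"
      by (simp_all add: stone_cech_def)
    have "left_preimage G x A \<in> i" if "x \<in> carrier G" for x
      by (rule ultrafilter_on_mono[OF ui Ai]) (use A that in \<open>auto simp: left_preimage_def\<close>)
    then have "{x \<in> carrier G. left_preimage G x A \<in> i} = carrier G" by blast
    then have "A \<in> beta_mult G t i"
      using A(1) ultrafilter_on_carrier[OF ut] by (simp add: beta_mult_def)
    then show "beta_mult G t i \<in> {q \<in> stone_cech G. A \<in> q}"
      by (simp add: stone_cech_def beta_mult_closed ut ui)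
    have "left_preimage G x A = carrier G" if "x \<in> A" for x
      using A that by (auto simp: left_preimage_def)
    then have "A \<subseteq> {x \<in> carrier G. left_preimage G x A \<in> t}"
      using A(1) ultrafilter_on_carrier[OF ut] by auto
    then have "A \<in> beta_mult G i t"
      using A(1) ultrafilter_on_mono[OF ui Ai] by (simp add: beta_mult_def)
    then show "beta_mult G i t \<in> {q \<in> stone_cech G. A \<in> q}"
      by (simp add: stone_cech_def beta_mult_closed ut ui)
  qed auto
  then show ?thesis
    using minimal_idempotent_mem_ideal[OF p] by blast
qed

text \<open>For a homomorphism, \<open>x^-1\<close> of the preimage of \<open>B\<close> is the
  preimage of \<open>(h x)^-1 B\<close>.\<close>

lemma pushforward_beta_mult:
  assumes h: "h \<in> hom G H" and G: "monoid G"
  shows "pushforward (carrier G) (carrier H) h (beta_mult G p q) =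
    beta_mult H (pushforward (carrier G) (carrier H) h p) (pushforward (carrier G) (carrier H) h q)"
proof -
  have "left_preimage G x {z \<in> carrier G. h z \<in> B} = {y \<in> carrier G. h y \<in> left_preimage H (h x) B}"
    if "x \<in> carrier G" for x B
    using h that monoid.m_closed[OF G] by (auto simp: left_preimage_def hom_def Pi_iff)
  moreover have "h x \<in> carrier H" if "x \<in> carrier G" for x
    using h that by (auto simp: hom_def)
  ultimately show ?thesis
    by (auto simp: beta_mult_def pushforward_def left_preimage_subset cong: conj_cong)
qed

section \<open>Subgroups of finite and of infinite index\<close>

text \<open>A two-sided ideal \<open>J\<close> of ultrafilters on \<open>H\<close> pulls back to a
  two-sided ideal of ultrafilters on \<open>G\<close>, which then contains \<open>p\<close>,
  provided that the pullback is nonempty. Finite index of the image is what makes \<open>J\<close>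
  meet the range of the extended map.\<close>

lemma (in group_hom) pushforward_minimal_idempotent:
  assumes p: "minimal_idempotent G p" and fin: "finite (rcosets\<^bsub>H\<^esub> (h ` carrier G))"
  shows "minimal_idempotent H (pushforward (carrier G) (carrier H) h p)"
proof -
  let ?h = "pushforward (carrier G) (carrier H) h" and ?K = "h ` carrier G"
  have K: "subgroup ?K H" by (rule img_is_subgroup)
  have KH: "?K \<subseteq> carrier H" using K subgroup.subset by blast
  have up: "ultrafilter_on (carrier G) p" by (rule minimal_idempotentD[OF p])
  have push: "?h q \<in> stone_cech H" if "q \<in> stone_cech G" for q
    using that ultrafilter_on_pushforward[OF _ KH] by (simp add: stone_cech_def)
  have mult: "?h (beta_mult G q r) = beta_mult H (?h q) (?h r)" for q r
    by (rule pushforward_beta_mult[OF homh G.is_monoid])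
  have "?h p \<in> J" if J: "two_sided_ideal (stone_cech H) (beta_mult H) J" for J
  proof -
    note J = two_sided_idealD[OF J]
    have "two_sided_ideal (stone_cech G) (beta_mult G) {q \<in> stone_cech G. ?h q \<in> J}"
    proof (rule two_sided_idealI)
      obtain j where j: "j \<in> J" using J by blast
      then have uj: "ultrafilter_on (carrier H) j"
        using J by (auto simp: stone_cech_def)
      obtain C where C: "C \<in> rcosets\<^bsub>H\<^esub> ?K" "C \<in> j"
        by (rule ultrafilter_on_finite_cover[OF uj fin H.rcosets_part_G[OF K]])
      then obtain a where a: "a \<in> carrier H" "C = ?K #>\<^bsub>H\<^esub> a"
        by (auto simp: RCOSETS_def)
      \<comment> \<open>Right translation by the inverse of \<open>a\<close> carries the coset
        \<open>C\<close> to the image subgroup, so the product of \<open>j\<close> and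
        \<open>e\<close> contains that subgroup and stays in \<open>J\<close>.\<close>
      define e where "e = principal_ultrafilter (carrier H) (inv\<^bsub>H\<^esub> a)"
      have e: "e \<in> stone_cech H"
        using a by (simp add: e_def stone_cech_def ultrafilter_on_principal)
      have j': "beta_mult H j e \<in> J"
        using J j e by blast
      have "C \<subseteq> {x \<in> carrier H. left_preimage H x ?K \<in> e}"
      proof
        fix x assume x: "x \<in> C"
        then have xH: "x \<in> carrier H"
          using ultrafilter_on_subset[OF uj C(2)] by blast
        have "x \<otimes>\<^bsub>H\<^esub> inv\<^bsub>H\<^esub> a \<in> ?K"
          using x xH a subgroup.rcos_module[OF K H.is_group] by blast
        then show "x \<in> {x \<in> carrier H. left_preimage H x ?K \<in> e}"
          using xH a by (simp add: e_def principal_ultrafilter_def left_preimage_subset)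
            (simp add: left_preimage_def)
      qed
      then have "?K \<in> beta_mult H j e"
        using ultrafilter_on_mono[OF uj C(2)] KH by (simp add: beta_mult_def)
      moreover have "ultrafilter_on (carrier H) (beta_mult H j e)"
        using j' J(1) by (auto simp: stone_cech_def)
      ultimately obtain q where "ultrafilter_on (carrier G) q" "?h q = beta_mult H j e"
        using pushforward_surj[OF _ KH] by blast
      then show "{q \<in> stone_cech G. ?h q \<in> J} \<noteq> {}"
        using j' by (auto simp: stone_cech_def)
    next
      fix t i assume t: "t \<in> stone_cech G" and i: "i \<in> {q \<in> stone_cech G. ?h q \<in> J}"
      then show "beta_mult G t i \<in> {q \<in> stone_cech G. ?h q \<in> J}"
        using G.beta_mult_closed J(3)[OF push[OF t]] by (simp add: stone_cech_def mult)
      show "beta_mult G i t \<in> {q \<in> stone_cech G. ?h q \<in> J}"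
        using t i G.beta_mult_closed J(4)[OF push[OF t]] by (simp add: stone_cech_def mult)
    qed auto
    then show ?thesis
      using minimal_idempotent_mem_ideal[OF p] by blast
  qed
  moreover have "beta_mult H (?h p) (?h p) = ?h p"
    using p by (simp add: mult[symmetric] minimal_idempotent_def)
  ultimately show ?thesis
    using push up by (simp add: minimal_idempotent_def smallest_ideal_def stone_cech_def)
qed

text \<open>The ultrafilters containing no coset of \<open>H\<close> form a two-sided ideal
  \<open>J\<close>, nonempty by infinite index. So \<open>p\<close> is in \<open>J\<close>, and
  \<open>H\<close> is one of its own cosets.\<close>

lemma (in comm_group) infinite_index_not_mem_minimal_idempotent:
  assumes H: "subgroup H G" and inf: "infinite (rcosets H)" and p: "minimal_idempotent G p"
  shows "H \<notin> p"
proof -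
  have HG: "H \<subseteq> carrier G" using H subgroup.subset by blast
  note coset_iff = subgroup.rcos_module[OF H is_group]
  define J where "J = {q \<in> stone_cech G. \<forall>C\<in>rcosets H. C \<notin> q}"
  have "two_sided_ideal (stone_cech G) (beta_mult G) J"
  proof (rule two_sided_idealI)
    \<comment> \<open>Finitely many cosets always leave out another one, so the complements of all
      cosets have the finite intersection property.\<close>
    obtain q where q: "ultrafilter_on (carrier G) q" "(\<lambda>C. carrier G - C) ` (rcosets H) \<subseteq> q"
    proof (rule ultrafilter_on_extends)
      fix \<F> assume "finite \<F>" "\<F> \<subseteq> (\<lambda>C. carrier G - C) ` (rcosets H)"
      then obtain \<D> where D: "\<D> \<subseteq> rcosets H" "finite \<D>" "\<F> = (\<lambda>C. carrier G - C) ` \<D>"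
        by (meson finite_subset_image)
      obtain C where C: "C \<in> rcosets H" "C \<notin> \<D>"
        using D inf by (metis finite_subset subsetI)
      obtain x where x: "x \<in> C"
        using subgroup.rcosets_non_empty[OF H C(1)] by blast
      have "x \<in> carrier G"
        using x C rcosets_part_G[OF H] by blast
      moreover have "x \<notin> D" if "D \<in> \<D>" for D
      proof -
        have "C \<noteq> D" "D \<in> rcosets H" using C(2) D(1) that by auto
        then have "disjnt C D"
          using pairwiseD[OF rcos_disjoint[OF H]] C(1) by blast
        then show ?thesis using x by (simp add: disjnt_iff)
      qed
      ultimately have "x \<in> carrier G \<inter> \<Inter>\<F>"
        by (simp add: D)
      then show "carrier G \<inter> \<Inter>\<F> \<noteq> {}" by blast
    qed auto
    have "C \<notin> q" if C: "C \<in> rcosets H" for C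
    proof -
      have "C \<subseteq> carrier G" using C rcosets_part_G[OF H] by blast
      moreover have "carrier G - C \<in> q" using q(2) C by blast
      ultimately show ?thesis using ultrafilter_on_Diff_iff[OF q(1)] by blast
    qed
    then have "q \<in> J"
      using q by (simp add: J_def stone_cech_def)
    then show "J \<noteq> {}" by blast
  next
    fix t i assume t: "t \<in> stone_cech G" and i: "i \<in> J"
    then have ut: "ultrafilter_on (carrier G) t" and ui: "ultrafilter_on (carrier G) i"
      and niC: "\<And>C. C \<in> rcosets H \<Longrightarrow> C \<notin> i"
      by (simp_all add: J_def stone_cech_def)
    have "C \<notin> beta_mult G t i" if "C \<in> rcosets H" for C
    proof -
      obtain a where a: "a \<in> carrier G" "C = H #> a"
        using \<open>C \<in> rcosets H\<close> by (auto simp: RCOSETS_def)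
      \<comment> \<open>Translations permute the cosets; commutativity makes \<open>x^-1 C\<close> a
        right coset again. Hence no \<open>x^-1 C\<close> is in \<open>i\<close>.\<close>
      have "left_preimage G x C = H #> (inv x \<otimes> a)" if x: "x \<in> carrier G" for x
      proof -
        have "x \<otimes> y \<otimes> inv a = y \<otimes> inv (inv x \<otimes> a)" if "y \<in> carrier G" for y
          using a x that by (simp add: inv_mult m_ac)
        then have "x \<otimes> y \<in> H #> a \<longleftrightarrow> y \<in> H #> (inv x \<otimes> a)" if "y \<in> carrier G" for y
          using a x that by (simp add: coset_iff)
        moreover have "H #> (inv x \<otimes> a) \<subseteq> carrier G"
          using a x by (intro r_coset_subset_G[OF HG]) simp
        ultimately show ?thesis
          unfolding left_preimage_def a(2) by blast
      qed
      then have "left_preimage G x C \<notin> i" if x: "x \<in> carrier G" for x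
        using niC[of "H #> (inv x \<otimes> a)"] x a rcosetsI[OF HG] by simp
      then have empty: "{x \<in> carrier G. left_preimage G x C \<in> i} = {}" by blast
      show ?thesis
        unfolding beta_mult_def mem_Collect_eq empty using ultrafilter_on_empty[OF ut] by blast
    qed
    then show "beta_mult G t i \<in> J"
      by (simp add: J_def stone_cech_def beta_mult_closed ut ui)
    have "C \<notin> beta_mult G i t" if "C \<in> rcosets H" for C
    proof
      obtain a where a: "a \<in> carrier G" "C = H #> a"
        using \<open>C \<in> rcosets H\<close> by (auto simp: RCOSETS_def)
      let ?X = "{x \<in> carrier G. left_preimage G x C \<in> t}"
      assume "C \<in> beta_mult G i t"
      then have X: "?X \<in> i" by (simp add: beta_mult_def)
      then have "?X \<noteq> {}" using ultrafilter_on_empty[OF ui] by metis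
      then obtain b where b: "b \<in> carrier G" "left_preimage G b C \<in> t" by blast
      \<comment> \<open>For \<open>x\<close> and \<open>b\<close> in \<open>?X\<close>, the sets
        \<open>x^-1 C\<close> and \<open>b^-1 C\<close> are both in \<open>t\<close> and share a
        point \<open>y\<close>. Then \<open>x y\<close> and \<open>b y\<close> lie in one coset, so
        \<open>x b^-1\<close> is in \<open>H\<close>. Thus \<open>?X\<close> sits in a single coset,
        which would have to be in \<open>i\<close>.\<close>
      have "?X \<subseteq> H #> b"
      proof
        fix x assume "x \<in> ?X"
        then have x: "x \<in> carrier G" "left_preimage G x C \<in> t" by auto
        then have "left_preimage G x C \<inter> left_preimage G b C \<in> t"
          using b ultrafilter_on_Int_iff[OF ut left_preimage_subset left_preimage_subset] by blast
        then have "left_preimage G x C \<inter> left_preimage G b C \<noteq> {}"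
          using ultrafilter_on_empty[OF ut] by metis
        then obtain y where y: "y \<in> carrier G" "x \<otimes> y \<in> C" "b \<otimes> y \<in> C"
          by (auto simp: left_preimage_def)
        then have "x \<otimes> y \<otimes> inv a \<in> H" "b \<otimes> y \<otimes> inv a \<in> H"
          using a b x by (simp_all add: coset_iff)
        then have "x \<otimes> y \<otimes> inv a \<otimes> inv (b \<otimes> y \<otimes> inv a) \<in> H"
          using H by (simp add: subgroup.m_closed subgroup.m_inv_closed)
        moreover have "x \<otimes> y \<otimes> inv a \<otimes> inv (b \<otimes> y \<otimes> inv a) = x \<otimes> inv b"
        proof -
          define c where "c = y \<otimes> inv a"
          have c: "c \<in> carrier G" using a y by (simp add: c_def)
          have "x \<otimes> y \<otimes> inv a = x \<otimes> c" "b \<otimes> y \<otimes> inv a = b \<otimes> c"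
            using a b x y by (simp_all add: c_def m_assoc)
          moreover have "x \<otimes> c \<otimes> inv (b \<otimes> c) = x \<otimes> inv b"
            using b x c by (simp add: inv_mult_group m_assoc inv_solve_left' flip: m_assoc[of c])
          ultimately show ?thesis by simp
        qed
        ultimately show "x \<in> H #> b"
          using b x by (simp add: coset_iff)
      qed
      then have "H #> b \<in> i"
        using ultrafilter_on_mono[OF ui X] r_coset_subset_G[OF HG] b by blast
      then show False
        using niC rcosetsI[OF HG] b by blast
    qed
    then show "beta_mult G i t \<in> J"
      by (simp add: J_def stone_cech_def beta_mult_closed ut ui)
  qed (simp add: J_def)
  then have "p \<in> J"
    by (rule minimal_idempotent_mem_ideal[OF p])
  then show ?thesis
    using subgroup.subgroup_in_rcosets[OF H is_group] by (auto simp: J_def)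
qed

section \<open>Integral domains\<close>

lemma (in domain) comm_monoid_mult_of: "comm_monoid (Multiplicative_Group.mult_of R)"
  by (rule comm_monoidI) (auto simp: integral_iff m_ac)

text \<open>Multiplication by \<open>x\<close> is an endomorphism of the additive group. Its image
  is the principal ideal of \<open>x\<close>, which is nonzero and so of finite index; hence minimal
  idempotents are pushed to minimal idempotents.\<close>

lemma (in domain) additively_central_scale:
  assumes large: "large_integral_domain R" and x: "x \<in> carrier R" "x \<noteq> \<zero>"
    and A: "additively_central R A"
  shows "additively_central R ((\<otimes>) x ` A)"
proof -
  obtain p where p: "minimal_idempotent (add_monoid R) p" "A \<in> p"
    using A by (auto simp: additively_central_def central_def)
  have up: "ultrafilter_on (carrier R) p"
    using minimal_idempotentD[OF p(1)] by simp
  have AR: "A \<subseteq> carrier R" using ultrafilter_on_subset[OF up p(2)] .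
  have "(\<otimes>) x \<in> hom (add_monoid R) (add_monoid R)"
    using x by (auto simp: hom_def r_distr)
  then interpret h: group_hom "add_monoid R" "add_monoid R" "(\<otimes>) x"
    by (simp add: group_hom_def group_hom_axioms_def add.is_group)
  have "(\<otimes>) x ` carrier R = PIdl x"
    using x by (auto simp: cgenideal_def m_comm)
  moreover have "PIdl x \<noteq> {\<zero>}"
    using x cgenideal_self by blast
  moreover have "ideal (PIdl x) R"
    using x(1) by (rule cgenideal_ideal)
  ultimately have "finite (rcosets\<^bsub>add_monoid R\<^esub> ((\<otimes>) x ` carrier (add_monoid R)))"
    using large by (simp add: large_integral_domain_def A_RCOSETS_def)
  then have "minimal_idempotent (add_monoid R) (pushforward (carrier R) (carrier R) ((\<otimes>) x) p)"
    using h.pushforward_minimal_idempotent[OF p(1)] by simp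
  moreover have "{y \<in> carrier R. x \<otimes> y \<in> (\<otimes>) x ` A} \<in> p"
    by (rule ultrafilter_on_mono[OF up p(2)]) (use AR in auto)
  then have "(\<otimes>) x ` A \<in> pushforward (carrier R) (carrier R) ((\<otimes>) x) p"
    using AR x by (auto simp: pushforward_def)
  ultimately show ?thesis
    unfolding additively_central_def central_def by blast
qed

text \<open>The set \<open>L\<close> is closed because its defining condition concerns one member of
  the ultrafilter at a time, and it is a left ideal because scaling by nonzero elements preserves
  additive centrality.\<close>

lemma (in domain) exists_mult_minimal_idempotent_additively_central:
  assumes "infinite (carrier R)" and large: "large_integral_domain R"
  obtains p where "minimal_idempotent (Multiplicative_Group.mult_of R) p" "\<forall>A\<in>p. additively_central R A"
proof -
  interpret M: comm_monoid "Multiplicative_Group.mult_of R" by (rule comm_monoid_mult_of)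
  define L where "L = {q. ultrafilter_on (carrier (Multiplicative_Group.mult_of R)) q \<and> (\<forall>A\<in>q. additively_central R A)}"
  have "closedin (stone_topology (carrier (Multiplicative_Group.mult_of R))) L"
    by (rule closedin_stone_topologyI) (auto simp: L_def)
  moreover have "L \<noteq> {}"
  proof -
    obtain e where e: "minimal_idempotent (add_monoid R) e"
      by (rule add.exists_minimal_idempotent)
    have ue: "ultrafilter_on (carrier R) e"
      using minimal_idempotentD[OF e] by simp
    \<comment> \<open>As \<open>R\<close> is infinite, the trivial subgroup has infinite index, so
      \<open>e\<close> is not concentrated at zero and restricts to an ultrafilter on the nonzero
      elements.\<close>
    have "infinite (rcosets\<^bsub>add_monoid R\<^esub> {\<zero>})"
    proof -
      have "rcosets\<^bsub>add_monoid R\<^esub> {\<zero>} = (\<lambda>x. {x}) ` carrier R"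
        by (auto simp: RCOSETS_def r_coset_def)
      moreover have "inj_on (\<lambda>x. {x}) (carrier R)" by simp
      ultimately show ?thesis
        using assms(1) finite_imageD by metis
    qed
    moreover have "subgroup {\<zero>} (add_monoid R)"
      using add.triv_subgroup by simp
    ultimately have "{\<zero>} \<notin> e"
      using add.infinite_index_not_mem_minimal_idempotent e by blast
    then have "carrier R - {\<zero>} \<in> e"
      using ultrafilter_on_Diff_iff[OF ue] by simp
    then have "{A \<in> e. A \<subseteq> carrier R - {\<zero>}} \<in> L"
      using ultrafilter_on_restrict[OF ue] e
      by (auto simp: L_def additively_central_def central_def)
    then show ?thesis by blast
  qed
  moreover have "beta_mult (Multiplicative_Group.mult_of R) t l \<in> L" if t: "t \<in> stone_cech (Multiplicative_Group.mult_of R)" and l: "l \<in> L" for t l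
  proof -
    have ut: "ultrafilter_on (carrier (Multiplicative_Group.mult_of R)) t" and ul: "ultrafilter_on (carrier (Multiplicative_Group.mult_of R)) l"
      and ac: "\<And>A. A \<in> l \<Longrightarrow> additively_central R A"
      using t l by (simp_all add: stone_cech_def L_def)
    have "additively_central R A" if A: "A \<in> beta_mult (Multiplicative_Group.mult_of R) t l" for A
    proof -
      \<comment> \<open>Some nonzero \<open>x\<close> has \<open>x^-1 A\<close> in \<open>l\<close>;
        scaling this set back by \<open>x\<close> gives an additively central subset of
        \<open>A\<close>.\<close>
      let ?X = "{x \<in> carrier (Multiplicative_Group.mult_of R). left_preimage (Multiplicative_Group.mult_of R) x A \<in> l}"
      have AR: "A \<subseteq> carrier R" and "?X \<in> t"
        using A by (auto simp: beta_mult_def)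
      then have "?X \<noteq> {}" using ultrafilter_on_empty[OF ut] by metis
      then obtain x where x: "x \<in> carrier R" "x \<noteq> \<zero>" "left_preimage (Multiplicative_Group.mult_of R) x A \<in> l" by auto
      then have "additively_central R ((\<otimes>) x ` left_preimage (Multiplicative_Group.mult_of R) x A)"
        using additively_central_scale[OF large] ac by blast
      moreover have "(\<otimes>) x ` left_preimage (Multiplicative_Group.mult_of R) x A \<subseteq> A"
        by (auto simp: left_preimage_def)
      ultimately show ?thesis
        using AR central_mono[of "add_monoid R" _ A] by (simp add: additively_central_def)
    qed
    then show ?thesis
      using M.beta_mult_closed[OF ut ul] by (simp add: L_def)
  qed
  ultimately obtain p where "p \<in> L" "minimal_idempotent (Multiplicative_Group.mult_of R) p"
    by (rule M.closed_left_ideal_has_minimal_idempotent)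
  then show thesis
    using that by (simp add: L_def)
qed

theorem theorem5p7:
  fixes R :: "('a, 'm) ring_scheme"
  assumes "domain R" and "infinite (carrier R)"
  shows "(\<forall>P. partition_on (carrier R) P \<and> finite P \<longrightarrow>
            (\<exists>C\<in>P. additively_central R C \<and> multiplicatively_central R C))
         \<longleftrightarrow> large_integral_domain R"
    (is "?partition \<longleftrightarrow> _")
proof -
  interpret domain R by fact
  interpret M: comm_monoid "Multiplicative_Group.mult_of R" by (rule comm_monoid_mult_of)
  have "large_integral_domain R" if part: ?partition
  proof -
    have "finite (a_rcosets\<^bsub>R\<^esub> I)" if I: "ideal I R" "I \<noteq> {\<zero>\<^bsub>R\<^esub>}" for I
    proof (rule ccontr)
      interpret I: ideal I R by fact
      assume inf: "infinite (a_rcosets\<^bsub>R\<^esub> I)"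
      \<comment> \<open>Cells of a partition are nonempty, so \<open>{}\<close> is removed to cover
        the case of an empty complement.\<close>
      let ?P = "{I, carrier R - I} - {{}}"
      have "partition_on (carrier R) ?P"
        using I.a_subset by (auto simp: partition_on_def disjoint_def)
      then obtain C where C: "C \<in> ?P" "additively_central R C" "multiplicatively_central R C"
        using part[rule_format, of ?P] by auto
      \<comment> \<open>A subgroup of infinite index belongs to no additive minimal
        idempotent.\<close>
      have "C \<noteq> I"
        using C(2) add.infinite_index_not_mem_minimal_idempotent[OF I.a_subgroup] inf
        by (auto simp: additively_central_def central_def A_RCOSETS_def)
      then have "C = carrier R - I" using C(1) by blast
      then obtain p where p: "minimal_idempotent (Multiplicative_Group.mult_of R) p" "carrier R - I - {\<zero>\<^bsub>R\<^esub>} \<in> p"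
        using C(3) by (auto simp: multiplicatively_central_def central_def)
      have up: "ultrafilter_on (carrier (Multiplicative_Group.mult_of R)) p"
        by (rule minimal_idempotentD[OF p(1)])
      \<comment> \<open>Absorption survives the removal of zero because there are no zero divisors.
        So \<open>p\<close> contains the nonzero elements of \<open>I\<close> as well as a set
        disjoint from them.\<close>
      have "two_sided_ideal (carrier (Multiplicative_Group.mult_of R)) (\<otimes>\<^bsub>Multiplicative_Group.mult_of R\<^esub>) (I - {\<zero>\<^bsub>R\<^esub>})"
        using I(2) I.a_subset I.zero_closed
        by (intro two_sided_idealI) (auto simp: I.I_l_closed I.I_r_closed integral_iff)
      then have "I - {\<zero>\<^bsub>R\<^esub>} \<in> p"
        by (rule M.ideal_mem_minimal_idempotent[OF p(1)])
      then have "(I - {\<zero>\<^bsub>R\<^esub>}) \<inter> (carrier R - I - {\<zero>\<^bsub>R\<^esub>}) \<in> p"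
        using p(2) ultrafilter_on_Int_iff[OF up] ultrafilter_on_subset[OF up] by blast
      moreover have "(I - {\<zero>\<^bsub>R\<^esub>}) \<inter> (carrier R - I - {\<zero>\<^bsub>R\<^esub>}) = {}" by blast
      ultimately show False
        using ultrafilter_on_empty[OF up] by simp
    qed
    then show ?thesis
      using assms(1) by (simp add: large_integral_domain_def)
  qed
  moreover have ?partition if large: "large_integral_domain R"
  proof -
    obtain p where p: "minimal_idempotent (Multiplicative_Group.mult_of R) p"
      and ac: "\<forall>A\<in>p. additively_central R A"
      by (rule exists_mult_minimal_idempotent_additively_central[OF assms(2) large])
    have up: "ultrafilter_on (carrier (Multiplicative_Group.mult_of R)) p"
      by (rule minimal_idempotentD[OF p])
    show ?thesis
    proof (intro allI impI, elim conjE)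
      fix P assume P: "partition_on (carrier R) P" "finite P"
      \<comment> \<open>The ultrafilter \<open>p\<close> lives on the nonzero elements, so zero is
        removed from each cell; for additive centrality it is put back by monotonicity.\<close>
      have cover: "\<Union>((\<lambda>C. C - {\<zero>\<^bsub>R\<^esub>}) ` P) = carrier (Multiplicative_Group.mult_of R)"
        using partition_onD1[OF P(1)] by auto
      obtain D where "D \<in> (\<lambda>C. C - {\<zero>\<^bsub>R\<^esub>}) ` P" "D \<in> p"
        by (rule ultrafilter_on_finite_cover[OF up finite_imageI[OF P(2)] cover])
      then obtain C where C: "C \<in> P" "C - {\<zero>\<^bsub>R\<^esub>} \<in> p" by blast
      have "multiplicatively_central R C"
        using C(2) p by (auto simp: multiplicatively_central_def central_def)
      moreover have "additively_central R C"
        unfolding additively_central_def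
      proof (rule central_mono)
        show "central (add_monoid R) (C - {\<zero>\<^bsub>R\<^esub>})"
          using ac C(2) by (simp add: additively_central_def)
      qed (use partition_onD1[OF P(1)] C(1) in auto)
      ultimately show "\<exists>C\<in>P. additively_central R C \<and> multiplicatively_central R C"
        using C(1) by blast
    qed
  qed
  ultimately show ?thesis by blast
qed

end
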